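(* Let $\mathcal{S}$ be a finite state space, $P$ a (time-homogeneous) transition matrix on $\mathcal{S}$, and $g:\mathcal{S}\times\mathcal{S}\to\mathbb{R}$ a reward function. Suppose that the Markov reward process $(P,g)$ is ergodic, i.e. its underlying Markov chain with transition matrix $P$ is irreducible and aperiodic, and let $\pi$ be its stationary distribution. Let $(X^{(j)}_t)_{t\ge 0}$, $j=0,1,2,\dots$, be independent realizations of the Markov chain with transition matrix $P$, each with initial state $X^{(j)}_0$ sampled from $\pi$, and let $r^{(j)}_t = g(X^{(j)}_t,X^{(j)}_{t+1})$ be the observed rewards. Then the reward process is ergodic: for every time step $t\in\mathbb{N}$ and every realization $i$, almost surely both limits below exist and $$\lim_{N\to\infty}\frac{1}{N}\sum_{j=0}^{N} r^{(j)}_{t} \;=\; \lim_{T\to\infty}\frac{1}{T}\sum_{\kappa=0}^{T} r^{(i)}_{\kappa}.$$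
   Context: A Markov reward process is a Markov chain on a state space $\mathcal{S}$ together with a reward function on transitions: when the chain moves from $X_t$ to $X_{t+1}$ the reward $r_t=g(X_t,X_{t+1})$ is received (rewards on states are the special case where $g(s,s')$ depends only on $s$). A Markov chain is called ergodic if it is irreducible and aperiodic; a Markov reward process is called ergodic if its underlying Markov chain is ergodic. The notation $r^{(j)}_t$ denotes the reward received at time step $t\in\mathbb{N}=\{0,1,2,\dots\}$ of the $j$-th trajectory, where the trajectories are independent realizations of the same stochastic process. A reward process is called (strongly) ergodic if, for all time steps $t$ and all realizations $i$, the ensemble average $\lim_{N\to\infty}\frac1N\sum_{j=0}^N r^{(j)}_t$ equals the time average $\lim_{T\to\infty}\frac1T\sum_{\kappa=0}^T r^{(i)}_\kappa$ almost surely. *)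

theory Defs
  imports "HOL-Probability.Probability"
begin

definition stochastic_matrix :: "real ^ 's ^ 's \<Rightarrow> bool" where
  "stochastic_matrix P \<longleftrightarrow> (\<forall>x y. 0 \<le> P $ x $ y) \<and> (\<forall>x. (\<Sum>y\<in>UNIV. P $ x $ y) = 1)"

(* The operation (^) on vectors of vectors is componentwise, so the n-step transition
   matrix has to be obtained by iterating the matrix product. *)
definition matrix_power :: "real ^ 's ^ 's \<Rightarrow> nat \<Rightarrow> real ^ 's ^ 's" where
  "matrix_power P n = (((**) P) ^^ n) (mat 1)"

definition irreducible_chain :: "real ^ 's ^ 's \<Rightarrow> bool" where
  "irreducible_chain P \<longleftrightarrow> (\<forall>x y. \<exists>n. 0 < matrix_power P n $ x $ y)"

(* The gcd of the empty set is 0, so a state without return times does not have period 1. *)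
definition state_period :: "real ^ 's ^ 's \<Rightarrow> 's \<Rightarrow> nat" where
  "state_period P x = Gcd {n. 0 < n \<and> 0 < matrix_power P n $ x $ x}"

definition aperiodic_chain :: "real ^ 's ^ 's \<Rightarrow> bool" where
  "aperiodic_chain P \<longleftrightarrow> (\<forall>x. state_period P x = 1)"

definition ergodic_chain :: "real ^ 's ^ 's \<Rightarrow> bool" where
  "ergodic_chain P \<longleftrightarrow> irreducible_chain P \<and> aperiodic_chain P"

definition stationary_distribution :: "real ^ 's ^ 's \<Rightarrow> real ^ 's \<Rightarrow> bool" where
  "stationary_distribution P \<pi> \<longleftrightarrow>
     (\<forall>x. 0 \<le> \<pi> $ x) \<and> (\<Sum>x\<in>UNIV. \<pi> $ x) = 1 \<and> \<pi> v* P = \<pi>"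

(* The guard is needed because cond_prob is 0 when the conditioning event is null. *)
definition markov_chain ::
    "'a measure \<Rightarrow> real ^ 's \<Rightarrow> real ^ 's ^ 's \<Rightarrow> (nat \<Rightarrow> 'a \<Rightarrow> 's) \<Rightarrow> bool" where
  "markov_chain M \<mu> P X \<longleftrightarrow>
     (\<forall>t. X t \<in> measurable M (count_space UNIV)) \<and>
     (\<forall>x. \<P>(\<omega> in M. X 0 \<omega> = x) = \<mu> $ x) \<and>
     (\<forall>t x y. 0 < \<P>(\<omega> in M. \<forall>k\<le>t. X k \<omega> = x k) \<longrightarrow>
        \<P>(\<omega> in M. X (Suc t) \<omega> = y \<bar> \<forall>k\<le>t. X k \<omega> = x k) = P $ x t $ y)"

(* Independence of whole trajectories, as random elements of the product space of paths. *)
definition independent_trajectories ::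
    "'a measure \<Rightarrow> (nat \<Rightarrow> nat \<Rightarrow> 'a \<Rightarrow> 's) \<Rightarrow> bool" where
  "independent_trajectories M X \<longleftrightarrow>
     prob_space.indep_vars M (\<lambda>j. \<Pi>\<^sub>M t\<in>UNIV. count_space UNIV) (\<lambda>j \<omega> t. X j t \<omega>) UNIV"

(* r j t is the reward at time t of trajectory j. Both averages have N + 1 summands and
   normalisation 1/N; the value of the quotient at N = 0 is irrelevant for the limit. *)
definition ergodic_reward_process ::
    "'a measure \<Rightarrow> (nat \<Rightarrow> nat \<Rightarrow> 'a \<Rightarrow> real) \<Rightarrow> bool" where
  "ergodic_reward_process M r \<longleftrightarrow>
     (\<forall>t i. AE \<omega> in M. \<exists>L.
        (\<lambda>N. (1 / real N) * (\<Sum>j=0..N. r j t \<omega>)) \<longlonglongrightarrow> L \<and>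
        (\<lambda>T. (1 / real T) * (\<Sum>\<kappa>=0..T. r i \<kappa> \<omega>)) \<longlonglongrightarrow> L)"

end

theory Submission
  imports Defs "HOL-Library.Discrete_Functions"
begin

text \<open>Both limits equal the stationary mean reward. Each is an instance of one law of large numbers:
  a bounded sequence of pairwise orthogonal random variables has averages tending to 0 almost
  surely, because the second moments of the averages along the squares are summable and boundedness
  controls the gaps between consecutive squares. For the ensemble average, orthogonality is
  independence of the trajectories. For the time average, a solution h of the Poisson equation
  h - P h = f - c (f the mean one-step reward, c its stationary mean) turns the centred rewards
  into martingale differences, which are orthogonal, up to a bounded telescoping term.\<close>

section \<open>A strong law for bounded orthogonal sequences\<close>

lemma floor_sqrt_at_top: "filterlim floor_sqrt at_top at_top"
  unfolding filterlim_at_top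
proof
  fix Z :: nat
  show "\<forall>\<^sub>F n in at_top. Z \<le> floor_sqrt n"
    using eventually_ge_at_top[of "Z\<^sup>2"] by eventually_elim (simp add: le_floor_sqrt_iff)
qed

text \<open>With \<open>k = floor_sqrt n\<close>, at most \<open>2 * k\<close> indices separate
  \<open>k\<^sup>2\<close> from \<open>n\<close>, so the sum changes by at most
  \<open>2 * k * B\<close> in the gap. Dividing by \<open>n\<close>, which is at least
  \<open>k\<^sup>2\<close>, leaves an error of \<open>2 * B / k\<close>.\<close>

lemma average_tendsto_0_of_squares:
  fixes u :: "nat \<Rightarrow> real"
  assumes bound: "\<And>i. \<bar>u i\<bar> \<le> B"
    and squares: "(\<lambda>k. (\<Sum>i<k\<^sup>2. u i) / (real k)\<^sup>2) \<longlonglongrightarrow> 0"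
  shows "(\<lambda>n. (\<Sum>i<n. u i) / real n) \<longlonglongrightarrow> 0"
proof (rule Lim_null_comparison)
  let ?k = "floor_sqrt"
  have B: "0 \<le> B" using bound[of 0] by linarith
  show "\<forall>\<^sub>F n in sequentially. norm ((\<Sum>i<n. u i) / real n)
      \<le> \<bar>(\<Sum>i<(?k n)\<^sup>2. u i) / (real (?k n))\<^sup>2\<bar> + 2 * B / real (?k n)"
    using eventually_gt_at_top[of 0]
  proof eventually_elim
    case (elim n)
    define k where "k = ?k n"
    have k: "0 < k" "k\<^sup>2 \<le> n" using elim by (simp_all add: k_def)
    have "n < (Suc k)\<^sup>2" unfolding k_def by (rule Suc_floor_sqrt_power2_gt)
    then have n: "n - k\<^sup>2 \<le> 2 * k" by (simp add: power2_eq_square)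
    have kn: "(real k)\<^sup>2 \<le> real n" using k(2) by (metis of_nat_le_iff of_nat_power)
    have "(\<Sum>i<n. u i) = (\<Sum>i<k\<^sup>2. u i) + (\<Sum>i=k\<^sup>2..<n. u i)"
      using k(2) by (simp add: lessThan_atLeast0 sum.atLeastLessThan_concat)
    moreover have "\<bar>\<Sum>i=k\<^sup>2..<n. u i\<bar> \<le> (\<Sum>i=k\<^sup>2..<n. B)"
      by (rule order_trans[OF sum_abs]) (intro sum_mono bound)
    moreover have "(\<Sum>i=k\<^sup>2..<n. B) \<le> 2 * real k * B"
    proof -
      have "real (n - k\<^sup>2) \<le> 2 * real k" using n by linarith
      then show ?thesis using mult_right_mono[OF _ B] by simp
    qed
    ultimately have "\<bar>\<Sum>i<n. u i\<bar> \<le> \<bar>\<Sum>i<k\<^sup>2. u i\<bar> + 2 * real k * B"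
      by linarith
    then have "\<bar>\<Sum>i<n. u i\<bar> / real n \<le> (\<bar>\<Sum>i<k\<^sup>2. u i\<bar> + 2 * real k * B) / real n"
      by (rule divide_right_mono) simp
    also have "\<dots> \<le> (\<bar>\<Sum>i<k\<^sup>2. u i\<bar> + 2 * real k * B) / (real k)\<^sup>2"
      using kn k(1) B elim by (intro divide_left_mono mult_pos_pos) auto
    also have "\<dots> = \<bar>(\<Sum>i<k\<^sup>2. u i) / (real k)\<^sup>2\<bar> + 2 * B / real k"
      using k(1) by (simp add: add_divide_distrib power2_eq_square abs_mult)
    finally show ?case by (simp add: k_def)
  qed
  have "(\<lambda>k. \<bar>(\<Sum>i<k\<^sup>2. u i) / (real k)\<^sup>2\<bar> + 2 * B / real k) \<longlonglongrightarrow> 0 + 0"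
    by (intro tendsto_add tendsto_rabs_zero squares lim_const_over_n)
  from filterlim_compose[OF this floor_sqrt_at_top]
  show "(\<lambda>n. \<bar>(\<Sum>i<(?k n)\<^sup>2. u i) / (real (?k n))\<^sup>2\<bar> + 2 * B / real (?k n)) \<longlonglongrightarrow> 0"
    by simp
qed

text \<open>The series of the squares has finite expectation, so it converges almost surely and its
  terms tend to 0. This takes the place of Chebyshev's inequality followed by
  Borel-Cantelli.\<close>

lemma (in prob_space) AE_tendsto_0_of_second_moments:
  fixes Y :: "nat \<Rightarrow> 'a \<Rightarrow> real"
  assumes [measurable]: "\<And>k. Y k \<in> borel_measurable M"
    and int: "\<And>k. integrable M (\<lambda>\<omega>. (Y k \<omega>)\<^sup>2)"
    and le: "\<And>k. expectation (\<lambda>\<omega>. (Y k \<omega>)\<^sup>2) \<le> a k"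
    and a: "summable a"
  shows "AE \<omega> in M. (\<lambda>k. Y k \<omega>) \<longlonglongrightarrow> 0"
proof -
  have a_nonneg: "0 \<le> a k" for k
    by (rule order_trans[OF integral_nonneg_AE le]) simp
  have "(\<integral>\<^sup>+\<omega>. (\<Sum>k. ennreal ((Y k \<omega>)\<^sup>2)) \<partial>M) = (\<Sum>k. \<integral>\<^sup>+\<omega>. ennreal ((Y k \<omega>)\<^sup>2) \<partial>M)"
    by (rule nn_integral_suminf) simp
  also have "\<dots> = (\<Sum>k. ennreal (expectation (\<lambda>\<omega>. (Y k \<omega>)\<^sup>2)))"
    by (intro suminf_cong nn_integral_eq_integral int) simp
  also have "\<dots> \<le> (\<Sum>k. ennreal (a k))"
    by (intro suminf_le ennreal_leI le) auto
  also have "\<dots> < \<infinity>"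
    using suminf_ennreal_eq[OF a_nonneg summable_sums[OF a]] by simp
  finally have "(\<integral>\<^sup>+\<omega>. (\<Sum>k. ennreal ((Y k \<omega>)\<^sup>2)) \<partial>M) \<noteq> \<infinity>" by simp
  then have "AE \<omega> in M. (\<Sum>k. ennreal ((Y k \<omega>)\<^sup>2)) \<noteq> \<infinity>"
    by (intro nn_integral_PInf_AE) auto
  then show ?thesis
  proof eventually_elim
    case (elim \<omega>)
    then have "summable (\<lambda>k. (Y k \<omega>)\<^sup>2)"
      by (intro summable_suminf_not_top) auto
    from summable_LIMSEQ_zero[OF this] have "(\<lambda>k. sqrt ((Y k \<omega>)\<^sup>2)) \<longlonglongrightarrow> sqrt 0"
      by (rule tendsto_real_sqrt)
    then show ?case by (simp add: tendsto_rabs_zero_iff)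
  qed
qed

text \<open>Orthogonality removes the cross terms, so the second moment of the sum of
  \<open>n\<close> terms grows only like \<open>n * B\<^sup>2\<close>. The average of the first
  \<open>k\<^sup>2\<close> terms then has second moment at most
  \<open>B\<^sup>2 / k\<^sup>2\<close>, which is summable.\<close>

lemma (in prob_space) strong_law_orthogonal:
  fixes U :: "nat \<Rightarrow> 'a \<Rightarrow> real"
  assumes meas [measurable]: "\<And>i. U i \<in> borel_measurable M"
    and bound: "\<And>i \<omega>. \<bar>U i \<omega>\<bar> \<le> B"
    and orth: "\<And>i j. i < j \<Longrightarrow> expectation (\<lambda>\<omega>. U i \<omega> * U j \<omega>) = 0"
  shows "AE \<omega> in M. (\<lambda>n. (\<Sum>i<n. U i \<omega>) / real n) \<longlonglongrightarrow> 0"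
proof -
  have int: "integrable M (\<lambda>\<omega>. U i \<omega> * U j \<omega>)" for i j
  proof (rule integrable_const_bound[where B = "B * B"])
    show "AE \<omega> in M. norm (U i \<omega> * U j \<omega>) \<le> B * B"
      using bound by (auto simp: abs_mult intro!: mult_mono order_trans[OF abs_ge_zero bound])
  qed simp
  have second: "expectation (\<lambda>\<omega>. (\<Sum>i<n. U i \<omega>)\<^sup>2) \<le> real n * B\<^sup>2" for n
  proof -
    have zero: "expectation (\<lambda>\<omega>. U i \<omega> * U j \<omega>) = 0" if "i \<noteq> j" for i j
      using orth[of i j] orth[of j i] that by (cases i j rule: linorder_cases) (auto simp: mult.commute)
    have "expectation (\<lambda>\<omega>. (\<Sum>i<n. U i \<omega>)\<^sup>2) = (\<Sum>i<n. \<Sum>j<n. expectation (\<lambda>\<omega>. U i \<omega> * U j \<omega>))"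
      by (simp add: power2_eq_square sum_product Bochner_Integration.integral_sum int)
    also have "\<dots> = (\<Sum>i<n. expectation (\<lambda>\<omega>. U i \<omega> * U i \<omega>))"
    proof (rule sum.cong[OF refl])
      fix i assume "i \<in> {..<n}"
      then show "(\<Sum>j<n. expectation (\<lambda>\<omega>. U i \<omega> * U j \<omega>)) = expectation (\<lambda>\<omega>. U i \<omega> * U i \<omega>)"
        using zero by (subst sum.remove[of _ i]) (auto intro!: sum.neutral)
    qed
    also have "\<dots> \<le> (\<Sum>i<n. B\<^sup>2)"
    proof (rule sum_mono)
      fix i
      have "U i \<omega> * U i \<omega> \<le> B\<^sup>2" for \<omega>
        using power_mono[OF bound[of i \<omega>], of 2] by (simp add: power2_eq_square)
      then show "expectation (\<lambda>\<omega>. U i \<omega> * U i \<omega>) \<le> B\<^sup>2"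
        by (intro integral_le_const int) simp
    qed
    finally show ?thesis by simp
  qed
  have "AE \<omega> in M. (\<lambda>k. (\<Sum>i<k\<^sup>2. U i \<omega>) / (real k)\<^sup>2) \<longlonglongrightarrow> 0"
  proof (rule AE_tendsto_0_of_second_moments)
    \<comment> \<open>At \<open>k = 0\<close> the average and this bound are both 0, since division
      by zero yields 0; the estimate therefore holds for every \<open>k\<close>.\<close>
    show "summable (\<lambda>k. B\<^sup>2 * (1 / (real k)\<^sup>2))"
      using inverse_power_summable[of 2, where ?'a = real]
      by (intro summable_mult) (simp add: inverse_eq_divide)
  next
    fix k
    show "integrable M (\<lambda>\<omega>. ((\<Sum>i<k\<^sup>2. U i \<omega>) / (real k)\<^sup>2)\<^sup>2)"
      by (simp add: power_divide power2_eq_square sum_product int Bochner_Integration.integrable_sum)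
    have "expectation (\<lambda>\<omega>. ((\<Sum>i<k\<^sup>2. U i \<omega>) / (real k)\<^sup>2)\<^sup>2)
        = expectation (\<lambda>\<omega>. (\<Sum>i<k\<^sup>2. U i \<omega>)\<^sup>2) / ((real k)\<^sup>2)\<^sup>2"
      by (simp add: power_divide)
    also have "\<dots> \<le> real (k\<^sup>2) * B\<^sup>2 / ((real k)\<^sup>2)\<^sup>2"
      by (intro divide_right_mono second) simp
    also have "\<dots> = B\<^sup>2 * (1 / (real k)\<^sup>2)"
      by (simp add: power2_eq_square)
    finally show "expectation (\<lambda>\<omega>. ((\<Sum>i<k\<^sup>2. U i \<omega>) / (real k)\<^sup>2)\<^sup>2) \<le> B\<^sup>2 * (1 / (real k)\<^sup>2)" .
  qed simp
  then show ?thesis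
    by eventually_elim (rule average_tendsto_0_of_squares[OF bound])
qed

text \<open>Bridges to the averages in the theorem, which have \<open>N + 1\<close> summands but
  normalisation \<open>1 / N\<close>: the correction factor \<open>(N + 1) / N\<close> tends to
  1.\<close>

lemma average_closed_interval_tendsto:
  fixes u :: "nat \<Rightarrow> real"
  assumes "(\<lambda>n. (\<Sum>i<n. u i - c) / real n) \<longlonglongrightarrow> 0"
  shows "(\<lambda>N. (1 / real N) * (\<Sum>i=0..N. u i)) \<longlonglongrightarrow> c"
proof -
  have "(\<lambda>N. (\<Sum>i<Suc N. u i - c) / real (Suc N)) \<longlonglongrightarrow> 0"
    using assms by (rule LIMSEQ_Suc)
  then have "(\<lambda>N. ((\<Sum>i<Suc N. u i - c) / real (Suc N) + c) * (real (Suc N) / real N)) \<longlonglongrightarrow> (0 + c) * 1"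
    by (intro tendsto_mult tendsto_add tendsto_const LIMSEQ_Suc_n_over_n)
  moreover have "\<forall>\<^sub>F N in sequentially. ((\<Sum>i<Suc N. u i - c) / real (Suc N) + c) * (real (Suc N) / real N)
      = (1 / real N) * (\<Sum>i=0..N. u i)"
    using eventually_gt_at_top[of 0]
  proof eventually_elim
    case (elim N)
    have "(\<Sum>i=0..N. u i) = (\<Sum>i<Suc N. u i - c) + real (Suc N) * c"
      by (simp add: sum_subtractf lessThan_Suc_atMost atMost_atLeast0 del: sum.lessThan_Suc)
    then show ?case
      using elim by (simp add: field_simps del: sum.lessThan_Suc of_nat_Suc)
  qed
  ultimately show ?thesis
    using Lim_transform_eventually by fastforce
qed

section \<open>The Poisson equation\<close>

lemma stochastic_matrix_mult:
  assumes "stochastic_matrix P" "stochastic_matrix Q"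
  shows "stochastic_matrix (P ** Q)"
proof -
  have "(\<Sum>y\<in>UNIV. (P ** Q) $ x $ y) = 1" for x
  proof -
    have "(\<Sum>y\<in>UNIV. (P ** Q) $ x $ y) = (\<Sum>z\<in>UNIV. P $ x $ z * (\<Sum>y\<in>UNIV. Q $ z $ y))"
      unfolding matrix_matrix_mult_def by (simp add: sum_distrib_left) (rule sum.swap)
    then show ?thesis using assms by (simp add: stochastic_matrix_def)
  qed
  then show ?thesis
    using assms by (auto simp: stochastic_matrix_def matrix_matrix_mult_def intro!: sum_nonneg)
qed

lemma stochastic_matrix_power:
  assumes "stochastic_matrix P"
  shows "stochastic_matrix (matrix_power P n)"
proof (induction n)
  case 0
  show ?case by (simp add: matrix_power_def stochastic_matrix_def mat_def)
next
  case (Suc n)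
  then show ?case using stochastic_matrix_mult[OF assms] by (simp add: matrix_power_def)
qed

lemma matrix_power_fixed_vector:
  assumes "P *v h = h"
  shows "matrix_power P n *v h = h"
  using assms
  by (induction n) (simp_all add: matrix_power_def matrix_vector_mul_assoc[symmetric])

text \<open>Maximum principle: at a maximum point of h, the average of h over the n-step
  transitions can only equal the maximum if h is maximal at every state reached.\<close>

lemma harmonic_imp_constant:
  fixes P :: "real ^ 's ^ 's"
  assumes P: "stochastic_matrix P" "irreducible_chain P" and h: "P *v h = h"
  obtains m where "\<And>x. h $ x = m"
proof -
  have "finite (range (($) h))" by simp
  then have "Max (range (($) h)) \<in> range (($) h)" by (intro Max_in) auto
  then obtain x where x: "Max (range (($) h)) = h $ x" by blast
  have le: "h $ y \<le> h $ x" for y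
    unfolding x[symmetric] by (rule Max_ge) auto
  have "h $ y = h $ x" for y
  proof -
    obtain n where n: "0 < matrix_power P n $ x $ y"
      using P(2) by (auto simp: irreducible_chain_def)
    let ?Q = "matrix_power P n"
    have Q: "stochastic_matrix ?Q" by (rule stochastic_matrix_power[OF P(1)])
    have "(\<Sum>z\<in>UNIV. ?Q $ x $ z * (h $ x - h $ z)) = (\<Sum>z\<in>UNIV. ?Q $ x $ z) * h $ x - (?Q *v h) $ x"
      by (simp add: matrix_vector_mult_def right_diff_distrib sum_subtractf sum_distrib_right)
    also have "\<dots> = 0"
      using Q by (simp add: stochastic_matrix_def matrix_power_fixed_vector[OF h])
    finally have "\<forall>z\<in>UNIV. ?Q $ x $ z * (h $ x - h $ z) = 0"
      using Q le by (subst (asm) sum_nonneg_eq_0_iff) (auto simp: stochastic_matrix_def)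
    then show ?thesis using n by (auto dest: spec[of _ y])
  qed
  then show ?thesis by (rule that)
qed

text \<open>Irreducibility makes the constants the only harmonic vectors, so \<open>I - P\<close>
  has a one-dimensional kernel. Subtracting the stationary mean of \<open>f\<close> puts the
  right-hand side into the range of \<open>I - P\<close>.\<close>

lemma poisson_equation:
  fixes P :: "real ^ 's ^ 's"
  assumes P: "stochastic_matrix P" "irreducible_chain P"
    and pi: "stationary_distribution P \<pi>"
  obtains h where "\<And>x. h $ x - (P *v h) $ x = f $ x - \<pi> \<bullet> f"
proof -
  have pi_P: "\<pi> \<bullet> (P *v h) = \<pi> \<bullet> h" for h
    using pi by (simp add: stationary_distribution_def flip: dot_lmul_matrix)
  have pi_const: "\<pi> \<bullet> (\<chi> _. c) = c" for c
    using pi by (simp add: stationary_distribution_def inner_vec_def flip: sum_distrib_right)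
  \<comment> \<open>The rank-one term makes the singular operator \<open>I - P\<close> invertible.\<close>
  define A where "A h = h - P *v h + (\<chi> _. \<pi> \<bullet> h)" for h
  have pi_A: "\<pi> \<bullet> A h = \<pi> \<bullet> h" for h
    by (simp add: A_def inner_add_right inner_diff_right pi_P pi_const)
  have lin: "linear A"
    by (rule linearI)
       (simp_all add: A_def vec_eq_iff matrix_vector_right_distrib matrix_vector_mult_scaleR
         inner_add_right algebra_simps)
  \<comment> \<open>Pairing \<open>A h = 0\<close> with \<open>\<pi>\<close> gives
    \<open>\<pi> \<bullet> h = 0\<close>. The rank-one term then vanishes, so \<open>h\<close> is
    harmonic, hence constant, and a constant with mean 0 is 0.\<close>
  have "inj A"
    unfolding linear_injective_0[OF lin]
  proof (intro allI impI)
    fix h assume "A h = 0"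
    then have pih: "\<pi> \<bullet> h = 0" using pi_A[of h] by simp
    with \<open>A h = 0\<close> have "P *v h = h" by (simp add: A_def vec_eq_iff)
    then obtain m where "\<And>x. h $ x = m" using harmonic_imp_constant[OF P] by blast
    then have h: "h = (\<chi> _. m)" by (simp add: vec_eq_iff)
    then have "m = 0" using pih pi_const[of m] by metis
    with h show "h = 0" by (simp add: vec_eq_iff)
  qed
  then have "surj A" by (rule linear_injective_imp_surjective[OF lin _ refl])
  then obtain h where h: "A h = f" by (metis surjD)
  \<comment> \<open>For this preimage of \<open>f\<close> the rank-one term is exactly the centring
    constant of the Poisson equation.\<close>
  then have "\<pi> \<bullet> h = \<pi> \<bullet> f" using pi_A[of h] by simp
  moreover have "f $ x = h $ x - (P *v h) $ x + \<pi> \<bullet> h" for x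
    unfolding h[symmetric] by (simp add: A_def)
  ultimately have "h $ x - (P *v h) $ x = f $ x - \<pi> \<bullet> f" for x
    by (simp only: add_diff_cancel_right')
  then show ?thesis by (rule that)
qed

section \<open>One-step conditioning along the chain\<close>

text \<open>Since the type of pairs is finite, discrete measurability reduces to preimages of single
  pairs, and each of these is an intersection of two events.\<close>

lemma measurable_pair_finite:
  fixes g :: "'s::finite \<times> 's \<Rightarrow> real"
  assumes [measurable]: "Y \<in> measurable M (count_space UNIV)" "Z \<in> measurable M (count_space UNIV)"
  shows "(\<lambda>\<omega>. g (Y \<omega>, Z \<omega>)) \<in> borel_measurable M"
proof -
  have "(\<lambda>\<omega>. (Y \<omega>, Z \<omega>)) \<in> measurable M (count_space UNIV)"
  proof (subst measurable_count_space_eq2; safe?)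
    fix a b
    have "(\<lambda>\<omega>. (Y \<omega>, Z \<omega>)) -` {(a, b)} \<inter> space M = {\<omega> \<in> space M. Y \<omega> = a \<and> Z \<omega> = b}"
      by auto
    then show "(\<lambda>\<omega>. (Y \<omega>, Z \<omega>)) -` {(a, b)} \<inter> space M \<in> sets M" by simp
  qed auto
  then show ?thesis by (rule measurable_compose) simp
qed

lemma markov_chain_measurable:
  "markov_chain M \<mu> P X \<Longrightarrow> X t \<in> measurable M (count_space UNIV)"
  by (simp add: markov_chain_def)

text \<open>A multiplicative Markov property without the positivity guard: if the past has
  probability 0, both sides vanish.\<close>

lemma (in prob_space) markov_chain_path_step:
  assumes mc: "markov_chain M \<mu> P X"
  shows "\<P>(\<omega> in M. (\<forall>k\<le>t. X k \<omega> = p k) \<and> X (Suc t) \<omega> = y)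
    = \<P>(\<omega> in M. \<forall>k\<le>t. X k \<omega> = p k) * P $ p t $ y"
proof (cases "0 < \<P>(\<omega> in M. \<forall>k\<le>t. X k \<omega> = p k)")
  case True
  then have "\<P>(\<omega> in M. X (Suc t) \<omega> = y \<bar> \<forall>k\<le>t. X k \<omega> = p k) = P $ p t $ y"
    using mc by (simp add: markov_chain_def)
  with True show ?thesis by (simp add: cond_prob_def conj_commute field_simps)
next
  case False
  have [measurable]: "X k \<in> measurable M (count_space UNIV)" for k
    by (rule markov_chain_measurable[OF mc])
  have "\<P>(\<omega> in M. (\<forall>k\<le>t. X k \<omega> = p k) \<and> X (Suc t) \<omega> = y) \<le> \<P>(\<omega> in M. \<forall>k\<le>t. X k \<omega> = p k)"
    by (intro finite_measure_mono) auto
  with False show ?thesis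
    using measure_nonneg[of M "{\<omega> \<in> space M. (\<forall>k\<le>t. X k \<omega> = p k) \<and> X (Suc t) \<omega> = y}"]
      measure_nonneg[of M "{\<omega> \<in> space M. \<forall>k\<le>t. X k \<omega> = p k}"]
    by simp
qed

text \<open>The tower property, with \<open>F\<close> an arbitrary weight depending on the path up
  to time \<open>t\<close>, obtained by splitting over the finitely many initial paths. The weight 1
  yields one-step means; an earlier increment as weight yields orthogonality.\<close>

lemma (in prob_space) markov_chain_expectation_step:
  fixes P :: "real ^ 's ^ 's" and F :: "(nat \<Rightarrow> 's) \<Rightarrow> real"
  assumes mc: "markov_chain M \<mu> P X"
  shows "expectation (\<lambda>\<omega>. F (restrict (\<lambda>k. X k \<omega>) {..t}) * u (X t \<omega>) (X (Suc t) \<omega>))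
    = expectation (\<lambda>\<omega>. F (restrict (\<lambda>k. X k \<omega>) {..t}) * (\<Sum>y\<in>UNIV. P $ X t \<omega> $ y * u (X t \<omega>) y))"
proof -
  note [measurable] = markov_chain_measurable[OF mc]
  \<comment> \<open>Extensional functions give each initial path exactly one representative, which
    makes \<open>Q\<close> finite and the events \<open>B p\<close> for \<open>p\<close> in
    \<open>Q\<close> a partition.\<close>
  define Q where "Q = PiE {..t} (\<lambda>_. UNIV :: 's set)"
  define B where "B p = {\<omega> \<in> space M. \<forall>k\<le>t. X k \<omega> = p k}" for p
  define A where "A p y = {\<omega> \<in> space M. (\<forall>k\<le>t. X k \<omega> = p k) \<and> X (Suc t) \<omega> = y}" for p y
  have [measurable]: "B p \<in> sets M" "A p y \<in> sets M" for p y
    unfolding A_def B_def by measurable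
  have Q: "finite Q" unfolding Q_def by (intro finite_PiE) auto
  have in_B: "\<omega> \<in> B p \<longleftrightarrow> restrict (\<lambda>k. X k \<omega>) {..t} = p" if "\<omega> \<in> space M" "p \<in> Q" for \<omega> p
    using that by (auto simp: B_def Q_def fun_eq_iff PiE_def extensional_def)
  have in_A: "\<omega> \<in> A p y \<longleftrightarrow> \<omega> \<in> B p \<and> X (Suc t) \<omega> = y" for \<omega> p y
    by (auto simp: A_def B_def)
  have prob_A: "prob (A p y) = prob (B p) * P $ p t $ y" for p y
    unfolding A_def B_def by (rule markov_chain_path_step[OF mc])
  have path: "restrict (\<lambda>k. X k \<omega>) {..t} \<in> Q" for \<omega> by (simp add: Q_def)
  have decomp: "(\<Sum>p\<in>Q. \<phi> p * indicator (B p) \<omega>) = \<phi> (restrict (\<lambda>k. X k \<omega>) {..t})"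
    if "\<omega> \<in> space M" for \<omega> and \<phi> :: "_ \<Rightarrow> real"
  proof -
    have "(\<Sum>p\<in>Q. \<phi> p * indicator (B p) \<omega>)
        = (\<Sum>p\<in>Q. if restrict (\<lambda>k. X k \<omega>) {..t} = p then \<phi> p else 0)"
      by (intro sum.cong) (auto simp: in_B[OF that] indicator_def)
    also have "\<dots> = \<phi> (restrict (\<lambda>k. X k \<omega>) {..t})"
      using path Q by simp
    finally show ?thesis .
  qed
  have "expectation (\<lambda>\<omega>. F (restrict (\<lambda>k. X k \<omega>) {..t}) * u (X t \<omega>) (X (Suc t) \<omega>))
      = expectation (\<lambda>\<omega>. \<Sum>p\<in>Q. \<Sum>y\<in>UNIV. F p * u (p t) y * indicator (A p y) \<omega>)"
  proof (intro Bochner_Integration.integral_cong refl)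
    fix \<omega> assume \<omega>: "\<omega> \<in> space M"
    have "(\<Sum>y\<in>UNIV. F p * u (p t) y * indicator (A p y) \<omega>)
        = (F p * u (p t) (X (Suc t) \<omega>)) * indicator (B p) \<omega>" for p
    proof -
      have "(\<Sum>y\<in>UNIV. F p * u (p t) y * indicator (A p y) \<omega>)
          = (\<Sum>y\<in>UNIV. if X (Suc t) \<omega> = y then F p * u (p t) y * indicator (B p) \<omega> else 0)"
        by (intro sum.cong) (auto simp: in_A indicator_def)
      then show ?thesis by simp
    qed
    then show "F (restrict (\<lambda>k. X k \<omega>) {..t}) * u (X t \<omega>) (X (Suc t) \<omega>)
        = (\<Sum>p\<in>Q. \<Sum>y\<in>UNIV. F p * u (p t) y * indicator (A p y) \<omega>)"
      using decomp[OF \<omega>, of "\<lambda>p. F p * u (p t) (X (Suc t) \<omega>)"] by simp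
  qed
  also have "\<dots> = (\<Sum>p\<in>Q. \<Sum>y\<in>UNIV. F p * u (p t) y * prob (A p y))"
    by (simp add: Bochner_Integration.integral_sum emeasure_eq_measure del: sum_mult_indicator)
  \<comment> \<open>The Markov property enters here, factoring \<open>prob (A p y)\<close> through
    \<open>prob (B p)\<close>.\<close>
  also have "\<dots> = (\<Sum>p\<in>Q. F p * (\<Sum>y\<in>UNIV. P $ p t $ y * u (p t) y) * prob (B p))"
    by (simp add: prob_A sum_distrib_left sum_distrib_right mult_ac)
  also have "\<dots> = expectation (\<lambda>\<omega>. \<Sum>p\<in>Q. F p * (\<Sum>y\<in>UNIV. P $ p t $ y * u (p t) y) * indicator (B p) \<omega>)"
    by (simp add: Bochner_Integration.integral_sum emeasure_eq_measure del: sum_mult_indicator)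
  also have "\<dots> = expectation (\<lambda>\<omega>. F (restrict (\<lambda>k. X k \<omega>) {..t}) * (\<Sum>y\<in>UNIV. P $ X t \<omega> $ y * u (X t \<omega>) y))"
    using decomp[of _ "\<lambda>p. F p * (\<Sum>y\<in>UNIV. P $ p t $ y * u (p t) y)"]
    by (intro Bochner_Integration.integral_cong refl) simp
  finally show ?thesis .
qed

text \<open>Going back one time step replaces \<open>f\<close> by \<open>P *v f\<close>, hence the
  induction over all \<open>f\<close>; stationarity moves \<open>P\<close> onto
  \<open>\<pi>\<close>, where it is absorbed.\<close>

lemma (in prob_space) stationary_expectation:
  fixes P :: "real ^ 's ^ 's"
  assumes mc: "markov_chain M \<pi> P X" and pi: "stationary_distribution P \<pi>"
  shows "expectation (\<lambda>\<omega>. f $ X t \<omega>) = \<pi> \<bullet> f"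
proof (induction t arbitrary: f)
  case 0
  note [measurable] = markov_chain_measurable[OF mc]
  define A where "A x = {\<omega> \<in> space M. X 0 \<omega> = x}" for x
  have [measurable]: "A x \<in> sets M" for x unfolding A_def by measurable
  have "expectation (\<lambda>\<omega>. f $ X 0 \<omega>) = expectation (\<lambda>\<omega>. \<Sum>x\<in>UNIV. f $ x * indicator (A x) \<omega>)"
  proof (intro Bochner_Integration.integral_cong refl)
    fix \<omega> assume "\<omega> \<in> space M"
    then have "(\<Sum>x\<in>UNIV. f $ x * indicator (A x) \<omega>) = (\<Sum>x\<in>UNIV. if X 0 \<omega> = x then f $ x else 0)"
      by (intro sum.cong) (auto simp: A_def indicator_def)
    then show "f $ X 0 \<omega> = (\<Sum>x\<in>UNIV. f $ x * indicator (A x) \<omega>)" by simp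
  qed
  also have "\<dots> = (\<Sum>x\<in>UNIV. f $ x * prob (A x))"
    by (simp add: Bochner_Integration.integral_sum emeasure_eq_measure del: sum_mult_indicator)
  also have "\<dots> = \<pi> \<bullet> f"
    using mc by (simp add: markov_chain_def A_def inner_vec_def mult.commute)
  finally show ?case .
next
  case (Suc t)
  have "expectation (\<lambda>\<omega>. f $ X (Suc t) \<omega>) = expectation (\<lambda>\<omega>. (P *v f) $ X t \<omega>)"
    using markov_chain_expectation_step[OF mc, of "\<lambda>_. 1" t "\<lambda>_ y. f $ y"]
    by (simp add: matrix_vector_mult_def)
  also have "\<dots> = \<pi> \<bullet> (P *v f)" by (rule Suc)
  also have "\<dots> = \<pi> \<bullet> f"
    using pi by (simp add: stationary_distribution_def flip: dot_lmul_matrix)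
  finally show ?case .
qed

section \<open>Ensemble averages and time averages\<close>

text \<open>The conditional mean of the next reward given the current state. As a vector it can be
  paired with \<open>\<pi>\<close> and serve as right-hand side of the Poisson equation.\<close>

definition mean_reward :: "real ^ 's ^ 's \<Rightarrow> ('s \<times> 's \<Rightarrow> real) \<Rightarrow> real ^ 's" where
  "mean_reward P g = (\<chi> x. \<Sum>y\<in>UNIV. P $ x $ y * g (x, y))"

lemma finite_type_bounded:
  fixes g :: "'s::finite \<Rightarrow> real"
  shows "\<exists>B. \<forall>x. \<bar>g x\<bar> \<le> B"
proof (intro exI allI)
  show "\<bar>g x\<bar> \<le> Max (range (\<lambda>x. \<bar>g x\<bar>))" for x
    by (rule Max_ge) auto
qed

lemma (in prob_space) expectation_reward:
  fixes P :: "real ^ 's ^ 's"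
  assumes mc: "markov_chain M \<pi> P X" and pi: "stationary_distribution P \<pi>"
  shows "expectation (\<lambda>\<omega>. g (X t \<omega>, X (Suc t) \<omega>)) = \<pi> \<bullet> mean_reward P g"
proof -
  have "expectation (\<lambda>\<omega>. g (X t \<omega>, X (Suc t) \<omega>)) = expectation (\<lambda>\<omega>. mean_reward P g $ X t \<omega>)"
    using markov_chain_expectation_step[OF mc, of "\<lambda>_. 1" t "\<lambda>x y. g (x, y)"]
    by (simp add: mean_reward_def)
  also have "\<dots> = \<pi> \<bullet> mean_reward P g"
    by (rule stationary_expectation[OF mc pi])
  finally show ?thesis .
qed

text \<open>At a fixed time \<open>t\<close> the rewards of different trajectories are independent,
  and by stationarity they share the mean \<open>\<pi> \<bullet> mean_reward P g\<close>. Once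
  centred they are orthogonal.\<close>

lemma (in prob_space) ensemble_average:
  fixes P :: "real ^ 's ^ 's" and g :: "'s \<times> 's \<Rightarrow> real"
  assumes mc: "\<And>j. markov_chain M \<pi> P (X j)" and pi: "stationary_distribution P \<pi>"
    and indep: "independent_trajectories M X"
  shows "AE \<omega> in M. (\<lambda>N. (1 / real N) * (\<Sum>j=0..N. g (X j t \<omega>, X j (Suc t) \<omega>)))
    \<longlonglongrightarrow> \<pi> \<bullet> mean_reward P g"
proof -
  note [measurable] = markov_chain_measurable[OF mc]
  define c where "c = \<pi> \<bullet> mean_reward P g"
  define U where "U = (\<lambda>j \<omega>. g (X j t \<omega>, X j (Suc t) \<omega>) - c)"
  obtain B where B: "\<And>z. \<bar>g z - c\<bar> \<le> B" using finite_type_bounded[of "\<lambda>z. g z - c"] by blast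
  have r_meas [measurable]: "(\<lambda>\<omega>. g (X j t \<omega>, X j (Suc t) \<omega>)) \<in> borel_measurable M" for j
    by (rule measurable_pair_finite[where g = g]) auto
  have U_meas [measurable]: "U j \<in> borel_measurable M" for j
    unfolding U_def by measurable
  have int: "integrable M (U j)" for j
    by (rule integrable_const_bound[where B = B]) (auto simp: B U_def)
  have mean: "expectation (U j) = 0" for j
  proof -
    have "integrable M (\<lambda>\<omega>. U j \<omega> + c)" using int by (intro Bochner_Integration.integrable_add) auto
    then have "integrable M (\<lambda>\<omega>. g (X j t \<omega>, X j (Suc t) \<omega>))" by (simp add: U_def)
    moreover have "expectation (\<lambda>\<omega>. g (X j t \<omega>, X j (Suc t) \<omega>)) = c"
      unfolding c_def by (rule expectation_reward[where X = "X j" and g = g, OF mc pi])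
    ultimately show ?thesis
      unfolding U_def by (simp add: prob_space)
  qed
  \<comment> \<open>Each \<open>U j\<close> is one and the same measurable function of the whole
    trajectory \<open>j\<close>, so it inherits independence from the path space.\<close>
  have indep_U: "indep_vars (\<lambda>_. borel) U UNIV"
  proof -
    have "(\<lambda>p. g (p t, p (Suc t)) - c) \<in> borel_measurable (\<Pi>\<^sub>M t\<in>(UNIV::nat set). count_space UNIV)"
      by (rule measurable_pair_finite[where g = "\<lambda>z. g z - c"]; rule measurable_component_singleton)
        simp_all
    then show ?thesis
      unfolding U_def
      by (intro indep_vars_compose2[OF indep[unfolded independent_trajectories_def],
            where Y = "\<lambda>_ p. g (p t, p (Suc t)) - c"])
  qed
  have "AE \<omega> in M. (\<lambda>n. (\<Sum>j<n. U j \<omega>) / real n) \<longlonglongrightarrow> 0"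
  proof (rule strong_law_orthogonal[where B = B])
    fix i j :: nat assume "i < j"
    then have "expectation (\<lambda>\<omega>. \<Prod>k\<in>{i, j}. U k \<omega>) = (\<Prod>k\<in>{i, j}. expectation (U k))"
      by (intro indep_vars_lebesgue_integral indep_vars_subset[OF indep_U] int) auto
    with \<open>i < j\<close> show "expectation (\<lambda>\<omega>. U i \<omega> * U j \<omega>) = 0"
      by (simp add: mean)
  qed (simp_all add: B U_def)
  then show ?thesis
    unfolding U_def c_def[symmetric] by eventually_elim (rule average_closed_interval_tendsto)
qed

text \<open>The initial law \<open>\<mu>\<close> is arbitrary: the increments have conditional mean
  0 given the past wherever the chain starts, and \<open>\<pi>\<close> enters through the centring
  constant.\<close>

lemma (in prob_space) time_average:
  fixes P :: "real ^ 's ^ 's" and g :: "'s \<times> 's \<Rightarrow> real"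
  assumes P: "stochastic_matrix P" "irreducible_chain P"
    and mc: "markov_chain M \<mu> P X" and pi: "stationary_distribution P \<pi>"
  shows "AE \<omega> in M. (\<lambda>T. (1 / real T) * (\<Sum>\<kappa>=0..T. g (X \<kappa> \<omega>, X (Suc \<kappa>) \<omega>)))
    \<longlonglongrightarrow> \<pi> \<bullet> mean_reward P g"
proof -
  note [measurable] = markov_chain_measurable[OF mc]
  define c where "c = \<pi> \<bullet> mean_reward P g"
  obtain h where h: "\<And>x. h $ x - (P *v h) $ x = mean_reward P g $ x - c"
    using poisson_equation[OF P pi] unfolding c_def by blast
  \<comment> \<open>By the Poisson equation, adding the coboundary of \<open>h\<close> to the centred rewards
    produces martingale differences.\<close>
  define d where "d z = g z - c - h $ fst z + h $ snd z" for z
  define U where "U = (\<lambda>t \<omega>. d (X t \<omega>, X (Suc t) \<omega>))"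
  have d_mean: "(\<Sum>y\<in>UNIV. P $ x $ y * d (x, y)) = 0" for x
  proof -
    have "(\<Sum>y\<in>UNIV. P $ x $ y * d (x, y))
        = mean_reward P g $ x - (\<Sum>y\<in>UNIV. P $ x $ y) * (c + h $ x) + (P *v h) $ x"
      by (simp add: d_def mean_reward_def matrix_vector_mult_def algebra_simps sum.distrib
          sum_subtractf sum_distrib_left)
    then show ?thesis using P(1) h[of x] by (simp add: stochastic_matrix_def)
  qed
  obtain B where B: "\<And>z. \<bar>d z\<bar> \<le> B" using finite_type_bounded[of d] by blast
  have "AE \<omega> in M. (\<lambda>n. (\<Sum>t<n. U t \<omega>) / real n) \<longlonglongrightarrow> 0"
  proof (rule strong_law_orthogonal[where B = B])
    show "U t \<in> borel_measurable M" for t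
      unfolding U_def by (rule measurable_pair_finite[where g = d]) auto
  next
    fix s t :: nat assume "s < t"
    \<comment> \<open>Since \<open>Suc s \<le> t\<close>, the earlier increment is a function of the
      path up to time \<open>t\<close> and can serve as the weight; averaging the later increment
      over the next state gives 0 by \<open>d_mean\<close>.\<close>
    then show "expectation (\<lambda>\<omega>. U s \<omega> * U t \<omega>) = 0"
      using markov_chain_expectation_step[OF mc, of "\<lambda>p. d (p s, p (Suc s))" t "\<lambda>x y. d (x, y)"]
      by (simp add: U_def d_mean)
  qed (simp_all add: B U_def)
  then have "AE \<omega> in M. (\<lambda>n. (\<Sum>t<n. g (X t \<omega>, X (Suc t) \<omega>) - c) / real n) \<longlonglongrightarrow> 0"
  proof eventually_elim
    case (elim \<omega>)
    obtain H where H: "\<And>x. \<bar>h $ x\<bar> \<le> H" using finite_type_bounded[of "($) h"] by blast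
    \<comment> \<open>This is what remains of the coboundary after telescoping. It is bounded by
      twice the sup norm of \<open>h\<close>, so it disappears after division by
      \<open>n\<close>.\<close>
    have "(\<lambda>n. (h $ X 0 \<omega> - h $ X n \<omega>) / real n) \<longlonglongrightarrow> 0"
    proof (rule Lim_null_comparison[OF _ lim_const_over_n[of "2 * H"]])
      have "\<bar>h $ X 0 \<omega> - h $ X n \<omega>\<bar> \<le> 2 * H" for n
        using H[of "X 0 \<omega>"] H[of "X n \<omega>"] by linarith
      then show "\<forall>\<^sub>F n in sequentially. norm ((h $ X 0 \<omega> - h $ X n \<omega>) / real n) \<le> 2 * H / real n"
        by (simp add: divide_right_mono)
    qed
    from tendsto_add[OF elim this]
    have "(\<lambda>n. ((\<Sum>t<n. U t \<omega>) + (h $ X 0 \<omega> - h $ X n \<omega>)) / real n) \<longlonglongrightarrow> 0"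
      by (simp add: add_divide_distrib)
    moreover have "(\<Sum>t<n. U t \<omega>) + (h $ X 0 \<omega> - h $ X n \<omega>) = (\<Sum>t<n. g (X t \<omega>, X (Suc t) \<omega>) - c)" for n
      by (induction n) (simp_all add: U_def d_def)
    ultimately show ?case by simp
  qed
  then show ?thesis
    unfolding c_def[symmetric] by eventually_elim (rule average_closed_interval_tendsto)
qed

theorem theorem4p1:
  fixes M :: "'a measure"
    and P :: "real ^ 's ^ 's"
    and \<pi> :: "real ^ 's"
    and g :: "'s \<times> 's \<Rightarrow> real"
    and X :: "nat \<Rightarrow> nat \<Rightarrow> 'a \<Rightarrow> 's"
  assumes "prob_space M"
    and "stochastic_matrix P"
    and "ergodic_chain P"
    and "stationary_distribution P \<pi>"
    and "\<And>j. markov_chain M \<pi> P (X j)"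
    and "independent_trajectories M X"
  shows "ergodic_reward_process M (\<lambda>j t \<omega>. g (X j t \<omega>, X j (Suc t) \<omega>))"
  unfolding ergodic_reward_process_def
proof (intro allI)
  interpret prob_space M by fact
  fix t i
  have "irreducible_chain P" using assms(3) by (simp add: ergodic_chain_def)
  \<comment> \<open>The common limit is a deterministic constant, the same for all \<open>t\<close>
    and \<open>i\<close>.\<close>
  from ensemble_average[OF assms(5,4,6), of g t] time_average[OF assms(2) this assms(5)[of i] assms(4), of g]
  show "AE \<omega> in M. \<exists>L.
      (\<lambda>N. (1 / real N) * (\<Sum>j=0..N. g (X j t \<omega>, X j (Suc t) \<omega>))) \<longlonglongrightarrow> L \<and>
      (\<lambda>T. (1 / real T) * (\<Sum>\<kappa>=0..T. g (X i \<kappa> \<omega>, X i (Suc \<kappa>) \<omega>))) \<longlonglongrightarrow> L"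
    by eventually_elim blast
qed

end
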